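(* Let $q$ be a power of a prime $p$, let $d\ge 2$ with $d\mid(q-1)$, and let $S_d=\{x^d:x\in\mathbb{F}_q^*\}$. Let $A,B\subset\mathbb{F}_q^*$ with $|A|,|B|\ge 2$, and let $\lambda\in\mathbb{F}_q^*$. If $q\ne p$, assume further that $\binom{|A|-1+\frac{q-1}{d}}{|A|}\not\equiv 0\pmod p$. If $AB+\lambda\subset S_d\cup\{0\}$, then $$|A||B|\le |S_d|+|B\cap(-\lambda A^{-1})|+|A|-1.$$ Moreover, if in addition $\lambda\in S_d$, then $|A||B|\le |S_d|+|B\cap(-\lambda A^{-1})|-1$.
   Context: $AB=\{ab:a\in A,b\in B\}$, $AB+\lambda=\{x+\lambda:x\in AB\}$, and $-\lambda A^{-1}=\{-\lambda a^{-1}:a\in A\}$. *)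

theory Defs
  imports "HOL-Number_Theory.Number_Theory" "HOL-Library.Cardinality"
begin

definition power_residues :: "nat \<Rightarrow> 'a::field set" where
  "power_residues d = {x ^ d | x. x \<noteq> 0}"

definition prod_set :: "'a::times set \<Rightarrow> 'a set \<Rightarrow> 'a set" where
  "prod_set A B = {a * b | a b. a \<in> A \<and> b \<in> B}"

definition shift_set :: "'a::plus set \<Rightarrow> 'a \<Rightarrow> 'a set" where
  "shift_set X c = {x + c | x. x \<in> X}"

definition neg_scaled_inverse :: "'a::field \<Rightarrow> 'a set \<Rightarrow> 'a set" where
  "neg_scaled_inverse c A = {- c * inverse a | a. a \<in> A}"

end

theory Submission
  imports Defs "HOL-Computational_Algebra.Polynomial"
begin

text \<open>
  Stepanov's method. Put \<open>N = |A|\<close> and \<open>m = (q - 1) / d\<close>, and let \<open>c\<^sub>a\<close> be the weights of Lagrange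
  interpolation at \<open>0\<close> with nodes \<open>A\<close>, so that \<open>\<Sum> c\<^sub>a g(a) = g(0)\<close> whenever \<open>deg g < N\<close>.
  Consider \<open>f(x) = \<Sum> c\<^sub>a (a x + \<lambda>)\<^bsup>N-1+m\<^esup> - \<lambda>\<^bsup>N-1\<^esup>\<close>. If \<open>(a b + \<lambda>)\<^bsup>m\<^esup> = 1\<close> for all
  \<open>a \<in> A\<close>, then for \<open>k < N\<close> the coefficient of \<open>(x - b)\<^bsup>k\<^esup>\<close> in the first sum is a multiple of
  \<open>\<Sum> c\<^sub>a a\<^bsup>k\<^esup> (a b + \<lambda>)\<^bsup>N-1-k\<^esup>\<close>, the value at \<open>0\<close> of a polynomial of degree less than \<open>N\<close>;
  hence \<open>f\<close> vanishes at \<open>b\<close> to order at least \<open>N\<close>, with a loss of one when some \<open>a b + \<lambda>\<close> is zero.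
  The binomial condition makes the coefficient of \<open>x\<^bsup>N\<^esup>\<close> in \<open>f\<close> nonzero, so the roots in \<open>B\<close> are
  bounded by \<open>deg f \<le> N - 1 + m\<close>. If \<open>\<lambda>\<^bsup>m\<^esup> = 1\<close>, then \<open>0\<close> is a further root of order at least \<open>N\<close>.
\<close>

section \<open>Lagrange interpolation at zero\<close>

text \<open>The weight \<open>c a\<close> is the value at 0 of the Lagrange basis polynomial
  \<open>l a\<close> of the node \<open>a\<close>; two polynomials of degree below
  \<open>card A\<close> that agree on \<open>A\<close> are equal.\<close>

lemma lagrange_weights_at_zero:
  fixes A :: "'a::field set"
  assumes "finite A" "A \<noteq> {}"
  obtains c where "\<And>g. degree g < card A \<Longrightarrow> (\<Sum>a\<in>A. c a * poly g a) = poly g 0"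
proof
  define l where "l = (\<lambda>a. smult (inverse (\<Prod>e\<in>A-{a}. a - e)) (\<Prod>e\<in>A-{a}. [:-e, 1:]))"
  have poly_l: "poly (l a) x = (if x = a then 1 else 0)" if "a \<in> A" "x \<in> A" for a x
    using that assms by (auto simp: l_def poly_prod)
  have degree_l: "degree (l a) < card A" if "a \<in> A" for a
  proof -
    have "degree (\<Prod>e\<in>A-{a}. [:-e, 1:]) \<le> (\<Sum>e\<in>A-{a}. 1)"
      using degree_prod_sum_le[of "A-{a}" "\<lambda>e. [:-e, 1:]"] assms by (simp add: o_def)
    also have "\<dots> < card A"
      using that assms by (simp add: card_gt_0_iff)
    finally show ?thesis
      unfolding l_def using degree_smult_le le_less_trans by blast
  qed
  fix g :: "'a poly"
  assume g: "degree g < card A"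
  define h where "h = (\<Sum>a\<in>A. smult (poly g a) (l a))"
  have "degree h < card A"
    unfolding h_def using assms degree_l
    by (intro degree_sum_less) (auto simp: card_gt_0_iff intro: le_less_trans[OF degree_smult_le])
  moreover have "poly h x = poly g x" if "x \<in> A" for x
  proof -
    have "poly h x = (\<Sum>a\<in>A. if x = a then poly g a else 0)"
      unfolding h_def poly_sum using that by (intro sum.cong) (auto simp: poly_l)
    thus ?thesis using that assms by simp
  qed
  ultimately have "h = g"
    using g by (intro poly_eqI_degree[of A]) auto
  hence "poly g 0 = poly h 0" by simp
  thus "(\<Sum>a\<in>A. poly (l a) 0 * poly g a) = poly g 0"
    by (simp add: h_def poly_sum mult.commute)
qed

text \<open>With N = \<open>card A\<close>, subtracting \<Prod>(x - e) from x^N lowers the degree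
  below N without changing the values on \<open>A\<close>. So the sum is the value of the difference
  at 0, namely -\<Prod>(-e).\<close>

lemma lagrange_weights_power_card_ne_0:
  fixes A :: "'a::field set"
  assumes "finite A" "A \<noteq> {}" "0 \<notin> A"
    and c: "\<And>g. degree g < card A \<Longrightarrow> (\<Sum>a\<in>A. c a * poly g a) = poly g 0"
  shows "(\<Sum>a\<in>A. c a * a ^ card A) \<noteq> 0"
proof -
  define P where "P = (\<Prod>e\<in>A. [:-e, 1:])"
  define g where "g = monom 1 (card A) - P"
  have degP: "degree P = card A"
    unfolding P_def by (subst degree_prod_sum_eq) auto
  moreover have "lead_coeff P = 1"
    unfolding P_def by (simp add: lead_coeff_prod)
  ultimately have coeff: "coeff g (card A) = 0"
    by (simp add: g_def)
  have "degree g \<le> card A"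
    unfolding g_def by (intro degree_diff_le) (auto simp: degP degree_monom_eq)
  moreover have "card A > 0"
    using assms by (simp add: card_gt_0_iff)
  ultimately have "degree g < card A"
    using coeff by (metis degree_0 leading_coeff_0_iff order_le_less)
  hence "(\<Sum>a\<in>A. c a * poly g a) = poly g 0"
    by (rule c)
  moreover have "poly g a = a ^ card A" if "a \<in> A" for a
    using that assms by (auto simp: g_def P_def poly_monom poly_prod)
  moreover have "poly g 0 \<noteq> 0"
  proof -
    have "(\<Prod>e\<in>A. - e) \<noteq> 0" using assms by (simp add: prod_zero_iff)
    thus ?thesis using \<open>card A > 0\<close> by (simp add: g_def P_def poly_monom poly_prod power_0_left)
  qed
  ultimately show ?thesis by simp
qed

section \<open>Orders of roots\<close>

lemma pcompose_power:
  fixes p r :: "'a::comm_semiring_1 poly"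
  shows "(p ^ k) \<circ>\<^sub>p r = (p \<circ>\<^sub>p r) ^ k"
  by (induction k) (simp_all add: pcompose_mult pcompose_1)

text \<open>Substituting x + b moves the root to 0, where multiplicity is read off the low
  coefficients. Unlike derivatives, these detect multiplicity in every characteristic.\<close>

lemma order_ge_iff_coeff_pcompose:
  fixes f :: "'a::field poly"
  assumes "f \<noteq> 0"
  shows "k \<le> order b f \<longleftrightarrow> (\<forall>i<k. coeff (f \<circ>\<^sub>p [:b, 1:]) i = 0)"
proof -
  have inv: "(f \<circ>\<^sub>p [:b, 1:]) \<circ>\<^sub>p [:-b, 1:] = f"
    by (simp flip: pcompose_assoc add: pcompose_pCons)
  have "k \<le> order b f \<longleftrightarrow> [:-b, 1:] ^ k dvd f"
    using assms by (simp add: order_divides)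
  also have "\<dots> \<longleftrightarrow> [:0, 1:] ^ k dvd f \<circ>\<^sub>p [:b, 1:]"
  proof
    assume "[:-b, 1:] ^ k dvd f"
    then obtain g where "f = [:-b, 1:] ^ k * g" ..
    hence "f \<circ>\<^sub>p [:b, 1:] = [:0, 1:] ^ k * (g \<circ>\<^sub>p [:b, 1:])"
      by (simp add: pcompose_mult pcompose_power pcompose_pCons)
    thus "[:0, 1:] ^ k dvd f \<circ>\<^sub>p [:b, 1:]" by simp
  next
    assume "[:0, 1:] ^ k dvd f \<circ>\<^sub>p [:b, 1:]"
    then obtain g where "f \<circ>\<^sub>p [:b, 1:] = [:0, 1:] ^ k * g" ..
    hence "(f \<circ>\<^sub>p [:b, 1:]) \<circ>\<^sub>p [:-b, 1:] = [:-b, 1:] ^ k * (g \<circ>\<^sub>p [:-b, 1:])"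
      by (simp add: pcompose_mult pcompose_power pcompose_pCons)
    thus "[:-b, 1:] ^ k dvd f" by (simp add: inv)
  qed
  also have "[:0, 1:] ^ k = (monom 1 k :: 'a poly)"
    by (simp add: monom_altdef)
  finally show ?thesis
    by (simp add: monom_1_dvd_iff')
qed

lemma sum_order_le_degree:
  fixes f :: "'a::idom poly"
  assumes "f \<noteq> 0" "finite B"
  shows "(\<Sum>b\<in>B. order b f) \<le> degree f"
proof -
  have "(\<Sum>b\<in>B. order b f) = (\<Sum>b\<in>B \<inter> set_mset (proots f). count (proots f) b)"
    using assms by (intro sum.mono_neutral_cong_right) (auto simp: order_root)
  also have "\<dots> \<le> (\<Sum>b\<in>set_mset (proots f). count (proots f) b)"
    by (intro sum_mono2) auto
  also have "\<dots> = size (proots f)"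
    by (simp add: size_multiset_overloaded_eq)
  also have "\<dots> \<le> degree f"
    by (rule size_proots_le)
  finally show ?thesis .
qed

section \<open>The auxiliary polynomial\<close>

definition stepanov_poly :: "'a::field set \<Rightarrow> ('a \<Rightarrow> 'a) \<Rightarrow> 'a \<Rightarrow> nat \<Rightarrow> 'a poly" where
  "stepanov_poly A c lam m =
     (\<Sum>a\<in>A. smult (c a) ([:lam, a:] ^ (card A - 1 + m))) - [:lam ^ (card A - 1):]"

lemma degree_stepanov_poly_le:
  assumes "finite A"
  shows "degree (stepanov_poly A c lam m) \<le> card A - 1 + m"
proof -
  have "degree ([:lam, a:] ^ (card A - 1 + m)) \<le> card A - 1 + m" for a
    using degree_power_le[of "[:lam, a:]" "card A - 1 + m"] by (auto split: if_splits)
  thus ?thesis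
    unfolding stepanov_poly_def using assms
    by (intro degree_diff_le degree_sum_le order.trans[OF degree_smult_le]) auto
qed

text \<open>The shift turns a x + lam into a x + (a b + lam), to which the binomial theorem
  applies.\<close>

lemma coeff_stepanov_poly_shift:
  assumes "k \<le> card A - 1 + m"
  shows "coeff (stepanov_poly A c lam m \<circ>\<^sub>p [:b, 1:]) k =
           of_nat ((card A - 1 + m) choose k) *
             (\<Sum>a\<in>A. c a * (a ^ k * (a * b + lam) ^ (card A - 1 + m - k)))
           - (if k = 0 then lam ^ (card A - 1) else 0)"
proof -
  have lin: "[:lam, a:] \<circ>\<^sub>p [:b, 1:] = [:a * b + lam, a:]" for a
    by (simp add: pcompose_pCons algebra_simps)
  have "coeff (stepanov_poly A c lam m \<circ>\<^sub>p [:b, 1:]) k =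
      (\<Sum>a\<in>A. c a * coeff ([:a * b + lam, a:] ^ (card A - 1 + m)) k)
      - coeff [:lam ^ (card A - 1):] k"
    by (simp add: stepanov_poly_def pcompose_diff pcompose_sum pcompose_smult pcompose_power lin coeff_sum)
  also have "coeff [:lam ^ (card A - 1):] k = (if k = 0 then lam ^ (card A - 1) else 0)"
    by (cases k) auto
  finally show ?thesis
    using assms by (simp add: coeff_linear_poly_power sum_distrib_left mult_ac)
qed

text \<open>The coefficient at \<open>card A\<close> for b = 0 is a product of three nonzero
  factors: the binomial, the weighted power sum and a power of \<open>lam\<close>.\<close>

lemma stepanov_poly_ne_0:
  fixes A :: "'a::field set"
  assumes "finite A" "A \<noteq> {}" "0 \<notin> A" "lam \<noteq> 0" "m > 0"
    and c: "\<And>g. degree g < card A \<Longrightarrow> (\<Sum>a\<in>A. c a * poly g a) = poly g 0"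
    and binom: "of_nat ((card A - 1 + m) choose card A) \<noteq> (0 :: 'a)"
  shows "stepanov_poly A c lam m \<noteq> 0"
proof
  assume "stepanov_poly A c lam m = 0"
  hence "coeff (stepanov_poly A c lam m \<circ>\<^sub>p [:0, 1:]) (card A) = 0" by simp
  moreover have "card A > 0" using assms by (simp add: card_gt_0_iff)
  ultimately have "of_nat ((card A - 1 + m) choose card A) *
      (\<Sum>a\<in>A. c a * (a ^ card A * lam ^ (card A - 1 + m - card A))) = 0"
    using \<open>m > 0\<close> by (subst (asm) coeff_stepanov_poly_shift) auto
  also have "(\<Sum>a\<in>A. c a * (a ^ card A * lam ^ (card A - 1 + m - card A))) =
      (\<Sum>a\<in>A. c a * a ^ card A) * lam ^ (card A - 1 + m - card A)"
    by (simp add: sum_distrib_right mult_ac)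
  finally show False
    using binom \<open>lam \<noteq> 0\<close> lagrange_weights_power_card_ne_0[OF assms(1-3) c] by simp
qed

lemma order_stepanov_poly_ge:
  fixes A :: "'a::field set"
  assumes "stepanov_poly A c lam m \<noteq> 0" "s \<le> card A"
    and c: "\<And>g. degree g < card A \<Longrightarrow> (\<Sum>a\<in>A. c a * poly g a) = poly g 0"
    and periodic: "\<And>a k. a \<in> A \<Longrightarrow> k < s \<Longrightarrow>
           (a * b + lam) ^ (card A - 1 + m - k) = (a * b + lam) ^ (card A - 1 - k)"
  shows "s \<le> order b (stepanov_poly A c lam m)"
  unfolding order_ge_iff_coeff_pcompose[OF assms(1)]
proof (intro allI impI)
  fix k assume k: "k < s"
  \<comment> \<open>The roles swap: \<open>b\<close> is fixed and the node is the variable. For k >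
    0 the value at 0 vanishes; for k = 0 it is cancelled by the constant in
    \<open>stepanov_poly\<close>.\<close>
  define g where "g = monom 1 k * [:lam, b:] ^ (card A - 1 - k)"
  have "degree g \<le> degree (monom (1::'a) k) + degree ([:lam, b:] ^ (card A - 1 - k))"
    unfolding g_def by (rule degree_mult_le)
  also have "\<dots> \<le> k + (card A - 1 - k)"
    using degree_power_le[of "[:lam, b:]" "card A - 1 - k"]
    by (intro add_mono) (auto simp: degree_monom_eq split: if_splits)
  also have "\<dots> < card A" using k assms(2) by simp
  finally have "(\<Sum>a\<in>A. c a * poly g a) = poly g 0" by (rule c)
  moreover have "poly g 0 = (if k = 0 then lam ^ (card A - 1) else 0)"
    by (simp add: g_def poly_monom)
  moreover have "(\<Sum>a\<in>A. c a * (a ^ k * (a * b + lam) ^ (card A - 1 + m - k))) =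
      (\<Sum>a\<in>A. c a * poly g a)"
    using periodic k by (intro sum.cong) (auto simp: g_def poly_monom algebra_simps)
  ultimately show "coeff (stepanov_poly A c lam m \<circ>\<^sub>p [:b, 1:]) k = 0"
    using k assms(2) by (subst coeff_stepanov_poly_shift) auto
qed

section \<open>Power residues in finite fields\<close>

text \<open>Multiplication by \<open>x\<close> permutes the nonzero elements, so it preserves their
  product.\<close>

lemma finite_field_power_card_minus_1:
  fixes x :: "'a::{field,finite}"
  assumes "x \<noteq> 0"
  shows "x ^ (CARD('a) - 1) = 1"
proof -
  have "bij_betw ((*) x) (UNIV - {0}) (UNIV - {0})"
    using assms by (intro bij_betwI[where g = "(*) (inverse x)"]) auto
  hence "(\<Prod>y\<in>UNIV - {0}. x * y) = \<Prod>(UNIV - {0})"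
    by (rule prod.reindex_bij_betw)
  hence "x ^ card (UNIV - {0 :: 'a}) * \<Prod>(UNIV - {0}) = \<Prod>(UNIV - {0})"
    by (simp add: prod.distrib)
  moreover have "\<Prod>(UNIV - {0 :: 'a}) \<noteq> 0" by simp
  ultimately have "x ^ card (UNIV - {0 :: 'a}) = 1"
    by (metis mult_cancel_right1)
  thus ?thesis by simp
qed

lemma card_nth_roots_le:
  fixes y :: "'a::idom"
  assumes "k > 0"
  shows "card {x. x ^ k = y} \<le> k"
proof -
  define P where "P = monom 1 k - [:y:]"
  have "coeff P k = 1" using assms by (cases k) (auto simp: P_def)
  hence "P \<noteq> 0" by auto
  hence "card {x. poly P x = 0} \<le> degree P" by (rule card_poly_roots_bound)
  also have "degree P \<le> k"
    unfolding P_def by (intro degree_diff_le) (auto simp: degree_monom_eq)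
  also have "{x. poly P x = 0} = {x. x ^ k = y}"
    by (simp add: P_def poly_monom)
  finally show ?thesis .
qed

lemma power_residue_power_eq_1:
  fixes x :: "'a::{field,finite}"
  assumes "d dvd CARD('a) - 1" "x \<in> power_residues d"
  shows "x ^ ((CARD('a) - 1) div d) = 1"
  using assms finite_field_power_card_minus_1
  by (auto simp: power_residues_def simp flip: power_mult)

text \<open>Upper bound: the residues are roots of x^((q-1)/d) = 1. Lower bound: the fibres of x^d
  over them have at most \<open>d\<close> elements each and cover the q - 1 nonzero
  elements.\<close>

lemma card_power_residues:
  assumes "d dvd CARD('a::{field,finite}) - 1"
  shows "card (power_residues d :: 'a set) = (CARD('a) - 1) div d"
proof -
  have "card {0::'a, 1} \<le> CARD('a)" by (intro card_mono) auto
  hence q: "CARD('a) - 1 > 0" by simp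
  hence d: "d > 0" using assms by (metis dvd_0_left_iff gr0I less_irrefl)
  have m: "(CARD('a) - 1) div d > 0" using assms q by (metis dvd_div_eq_0_iff gr0I less_irrefl)
  let ?S = "power_residues d :: 'a set"
  have "card ?S \<le> card {x::'a. x ^ ((CARD('a) - 1) div d) = 1}"
    using power_residue_power_eq_1[OF assms] by (intro card_mono) auto
  also have "\<dots> \<le> (CARD('a) - 1) div d"
    using m by (rule card_nth_roots_le)
  finally have le: "card ?S \<le> (CARD('a) - 1) div d" .
  have "CARD('a) - 1 = card (UNIV - {0 :: 'a})" by simp
  also have "\<dots> \<le> card (\<Union>y\<in>?S. {x. x ^ d = y})"
    by (intro card_mono) (auto simp: power_residues_def)
  also have "\<dots> \<le> (\<Sum>y\<in>?S. card {x. x ^ d = y})"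
    by (intro card_UN_le) simp
  also have "\<dots> \<le> (\<Sum>y\<in>?S. d)"
    using d by (intro sum_mono card_nth_roots_le)
  finally have "CARD('a) - 1 \<le> card ?S * d" by simp
  hence "(CARD('a) - 1) div d \<le> card ?S"
    using d by (metis div_le_mono div_mult_self_is_m)
  with le show ?thesis by simp
qed

lemma CHAR_eq_of_CARD_prime_power:
  assumes "prime p" "CARD('a::{field,finite}) = p ^ n"
  shows "CHAR('a) = p"
proof -
  have "CHAR('a) dvd p ^ n" using CHAR_dvd_CARD[where ?'a = 'a] assms by simp
  moreover have "prime CHAR('a)"
    by (rule prime_CHAR_semidom) (rule finite_imp_CHAR_pos, simp)
  ultimately show ?thesis
    using assms(1) by (metis prime_dvd_power primes_dvd_imp_eq)
qed

theorem theorem1p7: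
  fixes A B :: "'a::{field,finite} set" and lam :: 'a and p q n d :: nat
  assumes "prime p" and "n \<ge> 1" and "q = p ^ n" and "CARD('a) = q"
    and "d \<ge> 2" and "d dvd (q - 1)"
    and "A \<subseteq> UNIV - {0}" and "B \<subseteq> UNIV - {0}"
    and "card A \<ge> 2" and "card B \<ge> 2"
    and "lam \<noteq> 0"
    and "q \<noteq> p \<Longrightarrow> \<not> [(card A - 1 + (q - 1) div d) choose (card A) = 0] (mod p)"
    and "shift_set (prod_set A B) lam \<subseteq> power_residues d \<union> {0}"
  shows "card A * card B
           \<le> card (power_residues d :: 'a set) + card (B \<inter> neg_scaled_inverse lam A) + card A - 1
       \<and> (lam \<in> power_residues d \<longrightarrow>
           card A * card B
             \<le> card (power_residues d :: 'a set) + card (B \<inter> neg_scaled_inverse lam A) - 1)"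
proof -
  define m where "m = (q - 1) div d"
  define R where "R = B \<inter> neg_scaled_inverse lam A"
  have dvd: "d dvd CARD('a) - 1" using assms by simp
  have card_S: "card (power_residues d :: 'a set) = m"
    using card_power_residues[OF dvd] assms by (simp add: m_def)
  have "(1::'a) \<in> power_residues d"
    unfolding power_residues_def by (rule CollectI, rule exI[of _ 1]) simp
  hence "m > 0" unfolding card_S[symmetric] by (auto simp: card_gt_0_iff)
  have power_m: "x ^ m = 1" if "x \<in> power_residues d" for x :: 'a
    using power_residue_power_eq_1[OF dvd that] assms by (simp add: m_def)
  have in_S: "a * b + lam \<in> power_residues d \<union> {0}" if "a \<in> A" "b \<in> B" for a b
    using assms(13) that unfolding shift_set_def prod_set_def by blast
  have "\<not> p dvd (card A - 1 + m) choose card A"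
  proof (cases "q = p")
    case False
    thus ?thesis using assms(12) by (simp add: m_def cong_0_iff)
  next
    case True
    \<comment> \<open>Over a prime field, a \<mapsto> a b + lam injects \<open>A\<close> into the
      residues and 0, so \<open>card A\<close> \<le> m + 1. As d \<ge> 2, the upper index is at most
      2m \<le> p - 1, and p cannot divide its factorial.\<close>
    from \<open>card B \<ge> 2\<close> obtain b where b: "b \<in> B" by fastforce
    with assms have "b \<noteq> 0" by auto
    hence "card A = card ((\<lambda>a. a * b + lam) ` A)"
      by (intro card_image[symmetric] inj_onI) auto
    also have "\<dots> \<le> card (power_residues d \<union> {0 :: 'a})"
      using in_S b by (intro card_mono) auto
    also have "\<dots> \<le> m + 1"
      using card_Un_le[of "power_residues d" "{0::'a}"] card_S by simp
    finally have "card A \<le> m + 1" .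
    moreover have "m * 2 \<le> q - 1"
      using assms(5,6) by (metis dvd_div_mult_self m_def mult_le_mono2)
    ultimately have "card A - 1 + m < p"
      using True prime_gt_0_nat[OF assms(1)] by linarith
    moreover have "\<not> p dvd fact (card A - 1 + m)"
      using calculation assms(1) by (simp add: prime_dvd_fact_iff)
    moreover have "card A \<le> card A - 1 + m"
      using \<open>m > 0\<close> by linarith
    hence "((card A - 1 + m) choose card A) dvd fact (card A - 1 + m)"
      using binomial_fact_lemma[of "card A" "card A - 1 + m"] by (metis dvd_triv_right)
    ultimately show ?thesis by (meson dvd_trans)
  qed
  hence binom: "of_nat ((card A - 1 + m) choose card A) \<noteq> (0 :: 'a)"
    using CHAR_eq_of_CARD_prime_power[of p n, where ?'a = 'a] assms
    by (simp add: of_nat_eq_0_iff_char_dvd)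
  have A: "finite A" "A \<noteq> {}" "0 \<notin> A" and B: "finite B" "0 \<notin> B" using assms by auto
  obtain c where c: "\<And>g. degree g < card A \<Longrightarrow> (\<Sum>a\<in>A. c a * poly g a) = poly g 0"
    using lagrange_weights_at_zero A by blast
  define f where "f = stepanov_poly A c lam m"
  have "f \<noteq> 0"
    unfolding f_def using stepanov_poly_ne_0[OF A \<open>lam \<noteq> 0\<close> \<open>m > 0\<close> c binom] .
  have periodic: "t ^ (card A - 1 + m - k) = t ^ (card A - 1 - k)"
    if "k \<le> card A - 1" "t ^ m = 1" for t :: 'a and k
  proof -
    have "card A - 1 + m - k = (card A - 1 - k) + m" using that by simp
    thus ?thesis using that by (simp only: power_add mult_1_right)
  qed
  \<comment> \<open>\<open>R\<close> collects the \<open>b\<close> with a b + lam = 0 for some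
    \<open>a\<close>.\<close>
  have order_ge: "card A - (if b \<in> R then 1 else 0) \<le> order b f" if b: "b \<in> B" for b
    unfolding f_def
  proof (rule order_stepanov_poly_ge[OF _ _ c])
    fix a k assume a: "a \<in> A" and k: "k < card A - (if b \<in> R then 1 else 0)"
    show "(a * b + lam) ^ (card A - 1 + m - k) = (a * b + lam) ^ (card A - 1 - k)"
    proof (cases "a * b + lam = 0")
      case True
      have "a \<noteq> 0" using a A by auto
      with True have "b = - lam * inverse a"
        by (simp add: field_simps eq_neg_iff_add_eq_0)
      hence "b \<in> R" using a b by (auto simp: R_def neg_scaled_inverse_def)
      \<comment> \<open>Here k < \<open>card A\<close> - 1, so both exponents are positive and both
        powers of 0 vanish; at k = \<open>card A\<close> - 1 the right side would be 0^0 =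
        1.\<close>
      thus ?thesis using True k by (simp add: power_0_left)
    next
      case False
      hence "(a * b + lam) ^ m = 1" using in_S[OF a b] power_m by blast
      thus ?thesis using k by (intro periodic) (auto split: if_splits)
    qed
  qed (use \<open>f \<noteq> 0\<close> in \<open>auto simp: f_def\<close>)
  have "card A * card B = (\<Sum>b\<in>B. card A)" by simp
  \<comment> \<open>Adding back the lost units costs \<open>card R\<close> in total.\<close>
  also have "\<dots> \<le> (\<Sum>b\<in>B. order b f + (if b \<in> R then 1 else 0))"
    using order_ge by (intro sum_mono) (auto simp: le_diff_conv)
  also have "\<dots> = (\<Sum>b\<in>B. order b f) + card R"
    using B by (simp add: sum.distrib R_def flip: sum.inter_filter Int_def)
  finally have B_le: "card A * card B \<le> (\<Sum>b\<in>B. order b f) + card R" .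
  have degree: "degree f \<le> card A - 1 + m"
    unfolding f_def using A by (intro degree_stepanov_poly_le)
  have "(\<Sum>b\<in>B. order b f) \<le> degree f"
    using \<open>f \<noteq> 0\<close> B by (intro sum_order_le_degree)
  hence first: "card A * card B \<le> m + card R + card A - 1"
    using B_le degree assms(9) by linarith
  have second: "card A * card B \<le> m + card R - 1" if "lam \<in> power_residues d"
  proof -
    \<comment> \<open>At b = 0 every a b + lam equals \<open>lam\<close>, and lam^m = 1, so no order
      is lost.\<close>
    have "card A \<le> order 0 f"
      unfolding f_def
    proof (rule order_stepanov_poly_ge[OF _ _ c])
      fix a k assume "k < card A"
      hence "lam ^ (card A - 1 + m - k) = lam ^ (card A - 1 - k)"
        using power_m[OF that] by (intro periodic) auto
      thus "(a * 0 + lam) ^ (card A - 1 + m - k) = (a * 0 + lam) ^ (card A - 1 - k)"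
        by (simp only: mult_zero_right add_0_left)
    qed (use \<open>f \<noteq> 0\<close> in \<open>auto simp: f_def\<close>)
    \<comment> \<open>Since 0 lies outside \<open>B\<close>, it adds at least \<open>card A\<close>
      to the sum of orders, which removes \<open>card A\<close> from the first bound.\<close>
    moreover have "(\<Sum>b\<in>insert 0 B. order b f) \<le> degree f"
      using \<open>f \<noteq> 0\<close> B by (intro sum_order_le_degree) auto
    ultimately show ?thesis
      using B_le degree assms(9) B by simp
  qed
  from first second show ?thesis unfolding card_S R_def by blast
qed

end
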